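(* Let $\Omega$ be a domain in $\mathbb{C}^n$, let $p\in\Omega$, and let $\{\varphi_j\}$ be a sequence of holomorphic automorphisms of $\Omega$. Put $p_j=\varphi_j(p)$ and let $d\varphi_j(p)$ be the complex Jacobian matrix of $\varphi_j$ at $p$. Let $F$ be any convex invariant metric on $\Omega$ and, for each $j$, let $L_j=L_{p_j}$ be a stretching factor of $\Omega$ at $p_j$ induced by $F$. Then the sequence $$\tau_j=[d\varphi_j(p)]^{-1}\circ(\varphi_j(\cdot)-p_j):\Omega\to\mathbb{C}^n$$ converges subsequentially if and only if the sequence $$\sigma_j=L_j\circ(\varphi_j(\cdot)-p_j):\Omega\to\mathbb{C}^n$$ converges subsequentially.
   Context: A (complex Finsler) metric on a domain $\Omega\subset\mathbb{C}^n$ is an upper semicontinuous function $F$ on $\Omega\times\mathbb{C}^n$ such that (i) $F(x;v)\ge 0$ for all $(x,v)$, with $F(x;v)=0$ only if $v=0$; (ii) $F(x;cv)=|c|F(x;v)$ for all $(x,v)\in\Omega\times\mathbb{C}^n$ and $c\in\mathbb{C}$. The indicatrix of $F$ at $x$ is $I_{\Omega,F}(x)=\{v\in\mathbb{C}^n: F(x;v)<1\}$. The metric $F$ is convex if $I_{\Omega,F}(x)$ is a convex domain for every $x\in\Omega$. It is invariant if $F(\varphi(x);d\varphi(x)v)=F(x;v)$ for every holomorphic automorphism $\varphi$ of $\Omega$ and all $(x,v)$. Stretching factor: for $x\in\Omega$ choose a unit vector $u_1\in\mathbb{C}^n$ with $\mu_1(x):=F(x;u_1)=\max\{F(x;v):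 v\in\mathbb{C}^n, |v|=1\}$. Inductively, having chosen $u_1,\dots,u_\alpha$ ($1\le\alpha\le n-1$), choose a unit vector $u_{\alpha+1}\in V_\alpha$ with $\mu_{\alpha+1}(x):=F(x;u_{\alpha+1})=\max\{F(x;v): v\in V_\alpha, |v|=1\}$, where $V_\alpha$ is the orthogonal complement (for the standard Hermitian inner product) of $\{u_1,\dots,u_\alpha\}$ in $\mathbb{C}^n$. A stretching factor of $\Omega$ at $x$ induced by $F$ is the $\mathbb{C}$-linear map $L_x$ on $\mathbb{C}^n$ with $L_x(u_\alpha)=\mu_\alpha(x)e_\alpha$, $\alpha=1,\dots,n$, for any such choice, where $\{e_1,\dots,e_n\}$ is the standard basis. A sequence of holomorphic maps $\Omega\to\mathbb{C}^n$ converges subsequentially if it has a subsequence converging uniformly on compact subsets of $\Omega$ to a map into $\mathbb{C}^n$. *)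

theory Defs
  imports "HOL-Analysis.Analysis"
begin

text \<open>
  Points of \<open>\<complex>\<^sup>n\<close> are elements of \<^typ>\<open>complex ^ 'n\<close>; its norm is the Euclidean one. Where the
  coordinates have to be numbered \<open>1, \<dots>, n\<close>, the index type is in addition linearly ordered.
\<close>

definition domain :: "(complex ^ 'n) set \<Rightarrow> bool" where
  "domain S \<longleftrightarrow> open S \<and> connected S \<and> S \<noteq> {}"

definition hermitian_inner :: "complex ^ 'n \<Rightarrow> complex ^ 'n \<Rightarrow> complex" where
  "hermitian_inner v w = (\<Sum>i\<in>UNIV. v $ i * cnj (w $ i))"

text \<open>
  \<^const>\<open>has_derivative\<close> only asks for a real-linear derivative; complex linearity comes from the
  derivative being multiplication by a complex matrix. That matrix is then
  \<^term>\<open>jacobian f (at z)\<close>. The set \<open>S\<close> is meant to be open.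
\<close>

definition holomorphic_map_on :: "(complex ^ 'n \<Rightarrow> complex ^ 'm) \<Rightarrow> (complex ^ 'n) set \<Rightarrow> bool" where
  "holomorphic_map_on f S \<longleftrightarrow> (\<forall>z\<in>S. \<exists>A :: complex ^ 'n ^ 'm. (f has_derivative (\<lambda>v. A *v v)) (at z))"

definition holomorphic_automorphism ::
  "(complex ^ 'n) set \<Rightarrow> (complex ^ 'n \<Rightarrow> complex ^ 'n) \<Rightarrow> bool" where
  "holomorphic_automorphism \<Omega> \<phi> \<longleftrightarrow>
     bij_betw \<phi> \<Omega> \<Omega> \<and> holomorphic_map_on \<phi> \<Omega> \<and> holomorphic_map_on (inv_into \<Omega> \<phi>) \<Omega>"

definition upper_semicontinuous_on :: "'a::topological_space set \<Rightarrow> ('a \<Rightarrow> real) \<Rightarrow> bool" where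
  "upper_semicontinuous_on S f \<longleftrightarrow> (\<forall>a. openin (top_of_set S) {x \<in> S. f x < a})"

definition finsler_metric ::
  "(complex ^ 'n) set \<Rightarrow> (complex ^ 'n \<Rightarrow> complex ^ 'n \<Rightarrow> real) \<Rightarrow> bool" where
  "finsler_metric \<Omega> F \<longleftrightarrow>
     upper_semicontinuous_on (\<Omega> \<times> UNIV) (\<lambda>(x, v). F x v) \<and>
     (\<forall>x\<in>\<Omega>. \<forall>v. 0 \<le> F x v \<and> (F x v = 0 \<longrightarrow> v = 0)) \<and>
     (\<forall>x\<in>\<Omega>. \<forall>v c. F x (c *s v) = cmod c * F x v)"

definition indicatrix ::
  "(complex ^ 'n \<Rightarrow> complex ^ 'n \<Rightarrow> real) \<Rightarrow> complex ^ 'n \<Rightarrow> (complex ^ 'n) set" where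
  "indicatrix F x = {v. F x v < 1}"

definition convex_metric ::
  "(complex ^ 'n) set \<Rightarrow> (complex ^ 'n \<Rightarrow> complex ^ 'n \<Rightarrow> real) \<Rightarrow> bool" where
  "convex_metric \<Omega> F \<longleftrightarrow> (\<forall>x\<in>\<Omega>. domain (indicatrix F x) \<and> convex (indicatrix F x))"

definition invariant_metric ::
  "(complex ^ 'n) set \<Rightarrow> (complex ^ 'n \<Rightarrow> complex ^ 'n \<Rightarrow> real) \<Rightarrow> bool" where
  "invariant_metric \<Omega> F \<longleftrightarrow>
     (\<forall>\<phi>. holomorphic_automorphism \<Omega> \<phi> \<longrightarrow>
        (\<forall>x\<in>\<Omega>. \<forall>v. F (\<phi> x) (jacobian \<phi> (at x) *v v) = F x v))"

text \<open>
  The vectors \<open>u\<^sub>1, \<dots>, u\<^sub>n\<close> form a family \<open>u\<close> over the ordered index type, so that the orthogonal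
  complement of the vectors chosen before \<open>u \<alpha>\<close> is taken over all \<open>\<beta> < \<alpha>\<close>; for the least index
  this is the whole space. The types are written \<open>(complex, 'n) vec\<close> because the \<open>^\<close> notation
  would pin the sort of \<open>'n\<close> to \<^class>\<open>finite\<close>.
\<close>

definition complement_below ::
  "('n::{finite,linorder} \<Rightarrow> (complex, 'n) vec) \<Rightarrow> 'n \<Rightarrow> (complex, 'n) vec set" where
  "complement_below u \<alpha> = {v. \<forall>\<beta><\<alpha>. hermitian_inner v (u \<beta>) = 0}"

definition stretching_basis ::
  "((complex, 'n) vec \<Rightarrow> (complex, 'n) vec \<Rightarrow> real) \<Rightarrow> (complex, 'n) vec \<Rightarrow>
   ('n::{finite,linorder} \<Rightarrow> (complex, 'n) vec) \<Rightarrow> bool" where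
  "stretching_basis F x u \<longleftrightarrow>
     (\<forall>\<alpha>. norm (u \<alpha>) = 1 \<and> u \<alpha> \<in> complement_below u \<alpha> \<and>
          (\<forall>v \<in> complement_below u \<alpha>. norm v = 1 \<longrightarrow> F x v \<le> F x (u \<alpha>)))"

definition stretching_factor ::
  "((complex, 'n) vec \<Rightarrow> (complex, 'n) vec \<Rightarrow> real) \<Rightarrow> (complex, 'n::{finite,linorder}) vec \<Rightarrow>
   ((complex, 'n) vec \<Rightarrow> (complex, 'n) vec) \<Rightarrow> bool" where
  "stretching_factor F x L \<longleftrightarrow>
     Vector_Spaces.linear (*s) (*s) L \<and>
     (\<exists>u. stretching_basis F x u \<and> (\<forall>\<alpha>. L (u \<alpha>) = of_real (F x (u \<alpha>)) *s axis \<alpha> 1))"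

definition converges_subsequentially ::
  "(complex ^ 'n) set \<Rightarrow> (nat \<Rightarrow> complex ^ 'n \<Rightarrow> complex ^ 'm) \<Rightarrow> bool" where
  "converges_subsequentially \<Omega> f \<longleftrightarrow>
     (\<exists>r g. strict_mono r \<and>
        (\<forall>K. compact K \<and> K \<subseteq> \<Omega> \<longrightarrow> uniform_limit K (\<lambda>k. f (r k)) g sequentially))"

end

theory Submission
  imports Defs
begin

text \<open>
  Convexity makes \<open>F(p\<^sub>j; \<cdot>)\<close> a complex norm. At a vector \<open>u\<close> maximising a norm on the unit sphere
  of a subspace, the coefficient of \<open>v\<close> along \<open>u\<close> times the norm of \<open>u\<close> is at most the norm of
  \<open>v\<close>; applied successively to \<open>u\<^sub>1, u\<^sub>2, \<dots>\<close> this shows that \<open>\<bar>L\<^sub>j v\<bar>\<close> and \<open>F(p\<^sub>j; v)\<close> are comparable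
  with constants depending only on \<open>n\<close>. By invariance \<open>F(p\<^sub>j; d\<phi>\<^sub>j(p) v) = F(p; v)\<close>, so the matrices
  \<open>M\<^sub>j = L\<^sub>j d\<phi>\<^sub>j(p)\<close> and their inverses are uniformly bounded. Since \<open>\<sigma>\<^sub>j = M\<^sub>j \<tau>\<^sub>j\<close>, convergence passes
  between the two sequences along a subsequence on which the matrices converge.
\<close>

section \<open>Hermitian inner product and orthonormal bases\<close>

lemma hermitian_inner_cnj: "hermitian_inner w v = cnj (hermitian_inner v w)"
  by (simp add: hermitian_inner_def mult.commute)

lemma hermitian_inner_add_left: "hermitian_inner (v + w) z = hermitian_inner v z + hermitian_inner w z"
  by (simp add: hermitian_inner_def sum.distrib algebra_simps)

lemma hermitian_inner_diff_left: "hermitian_inner (v - w) z = hermitian_inner v z - hermitian_inner w z"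
  by (simp add: hermitian_inner_def sum_subtractf algebra_simps)

lemma hermitian_inner_scale_left: "hermitian_inner (c *s v) z = c * hermitian_inner v z"
  by (simp add: hermitian_inner_def sum_distrib_left algebra_simps)

lemma hermitian_inner_sum_left: "hermitian_inner (\<Sum>i\<in>A. f i) z = (\<Sum>i\<in>A. hermitian_inner (f i) z)"
  by (induction A rule: infinite_finite_induct)
    (auto simp: hermitian_inner_add_left, auto simp: hermitian_inner_def)

lemma hermitian_inner_self: "hermitian_inner v v = of_real ((norm v)\<^sup>2)"
proof -
  have "(norm v)\<^sup>2 = (\<Sum>i\<in>UNIV. (cmod (v $ i))\<^sup>2)"
    by (simp add: norm_vec_def L2_set_def sum_nonneg)
  then show ?thesis
    by (simp only: hermitian_inner_def of_real_sum complex_norm_square)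
qed

lemma Re_hermitian_inner: "Re (hermitian_inner v w) = v \<bullet> w"
  by (simp add: hermitian_inner_def inner_vec_def inner_complex_def)

lemma norm_vector_scale: "norm (c *s v) = cmod c * norm (v :: complex ^ 'n)"
proof -
  have "norm (c *s v) = L2_set (\<lambda>i. cmod c * cmod (v $ i)) UNIV"
    by (simp add: norm_vec_def norm_mult)
  also have "\<dots> = cmod c * norm v"
    by (simp add: norm_vec_def L2_set_right_distrib)
  finally show ?thesis .
qed

text \<open>Orthonormality says \<open>H ** U = mat 1\<close>, where \<open>U\<close> has the
  columns \<open>u \<alpha>\<close> and \<open>H\<close> is its conjugate transpose. For square
  matrices this yields \<open>U ** H = mat 1\<close>, and applying that identity to \<open>v\<close>
  is the expansion.\<close>

lemma orthonormal_expansion: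
  fixes u :: "'n::finite \<Rightarrow> complex ^ 'n"
  assumes "\<And>\<alpha> \<beta>. hermitian_inner (u \<alpha>) (u \<beta>) = (if \<alpha> = \<beta> then 1 else 0)"
  shows "v = (\<Sum>\<alpha>\<in>UNIV. hermitian_inner v (u \<alpha>) *s u \<alpha>)"
proof -
  define U :: "complex ^ 'n ^ 'n" where "U = (\<chi> i \<alpha>. u \<alpha> $ i)"
  define H :: "complex ^ 'n ^ 'n" where "H = (\<chi> \<alpha> i. cnj (u \<alpha> $ i))"
  have "(H ** U) $ \<alpha> $ \<beta> = hermitian_inner (u \<beta>) (u \<alpha>)" for \<alpha> \<beta>
    by (simp add: matrix_matrix_mult_def U_def H_def hermitian_inner_def mult.commute)
  then have "H ** U = mat 1"
    using assms by (auto simp: vec_eq_iff mat_def)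
  then have "U ** H = mat 1"
    using matrix_left_right_inverse by blast
  then have "v = U *v (H *v v)"
    by (simp add: matrix_vector_mul_assoc)
  also have "H *v v = (\<chi> \<alpha>. hermitian_inner v (u \<alpha>))"
    by (simp add: vec_eq_iff matrix_vector_mult_def H_def hermitian_inner_def mult.commute)
  also have "U *v \<dots> = (\<Sum>\<alpha>\<in>UNIV. hermitian_inner v (u \<alpha>) *s u \<alpha>)"
    by (simp add: vec_eq_iff matrix_vector_mult_def U_def mult.commute)
  finally show ?thesis .
qed

text \<open>The construction makes each vector orthogonal to the earlier ones; conjugate symmetry
  supplies the other order.\<close>

lemma stretching_basis_orthonormal:
  assumes "stretching_basis F x u"
  shows "hermitian_inner (u \<alpha>) (u \<beta>) = (if \<alpha> = \<beta> then 1 else 0)"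
proof -
  have unit: "hermitian_inner (u \<alpha>) (u \<alpha>) = 1" for \<alpha>
    using assms by (simp add: stretching_basis_def hermitian_inner_self)
  have orth: "hermitian_inner (u \<alpha>) (u \<beta>) = 0" if "\<beta> < \<alpha>" for \<alpha> \<beta>
    using assms that by (simp add: stretching_basis_def complement_below_def)
  show ?thesis
    using unit orth[of \<beta> \<alpha>] orth[of \<alpha> \<beta>] hermitian_inner_cnj[of "u \<alpha>" "u \<beta>"]
    by (cases \<alpha> \<beta> rule: linorder_cases) auto
qed

section \<open>Complex norms and their maximising vectors\<close>

locale complex_norm =
  fixes N :: "complex ^ 'n \<Rightarrow> real"
  assumes nonneg: "0 \<le> N v"
    and eq_zero: "N v = 0 \<Longrightarrow> v = 0"
    and scale: "N (c *s v) = cmod c * N v"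
    and triangle: "N (v + w) \<le> N v + N w"
begin

lemma zero: "N 0 = 0"
  using scale[of 0 0] by simp

lemma minus: "N (- v) = N v"
proof -
  have "- v = (-1) *s v" by (simp add: vec_eq_iff)
  then show ?thesis using scale[of "-1" v] by (metis mult_1 norm_minus_cancel norm_one)
qed

lemma triangle_diff: "N (v - w) \<le> N v + N w"
  using triangle[of v "- w"] by (simp add: minus)

lemma sum_le: "N (\<Sum>i\<in>A. f i) \<le> (\<Sum>i\<in>A. N (f i))"
proof (induction A rule: infinite_finite_induct)
  case (insert i A)
  then show ?case using triangle[of "f i" "sum f A"] by simp
qed (auto simp: zero)

lemma bound_above: "\<exists>C>0. \<forall>v. N v \<le> C * norm v"
proof (intro exI conjI allI)
  let ?S = "\<Sum>i\<in>UNIV. N (axis i 1)"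
  \<comment> \<open>The added 1 turns nonnegativity of \<open>?S\<close> into strict
    positivity.\<close>
  show "0 < ?S + 1" using sum_nonneg[of UNIV "\<lambda>i. N (axis i 1)"] nonneg by fastforce
  fix v
  have "N v = N (\<Sum>i\<in>UNIV. v $ i *s axis i 1)" by (simp add: basis_expansion)
  also have "\<dots> \<le> (\<Sum>i\<in>UNIV. cmod (v $ i) * N (axis i 1))"
    using sum_le[of "\<lambda>i. v $ i *s axis i 1" UNIV] by (simp add: scale)
  also have "\<dots> \<le> (\<Sum>i\<in>UNIV. norm v * N (axis i 1))"
    by (intro sum_mono mult_right_mono nonneg) (simp add: Finite_Cartesian_Product.norm_nth_le)
  also have "\<dots> \<le> (?S + 1) * norm v"
    by (simp add: sum_distrib_left algebra_simps)
  finally show "N v \<le> (?S + 1) * norm v" .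
qed

lemma continuous: "continuous_on A N"
proof -
  obtain C where C: "C > 0" "\<And>v. N v \<le> C * norm v"
    using bound_above by blast
  have "C-lipschitz_on A N"
  proof (rule lipschitz_onI)
    fix v w
    have "\<bar>N v - N w\<bar> \<le> N (v - w)"
      using triangle[of "v - w" w] triangle[of "w - v" v] minus[of "v - w"] by simp
    also have "\<dots> \<le> C * dist v w" using C by (simp add: dist_norm)
    finally show "dist (N v) (N w) \<le> C * dist v w" by (simp add: dist_real_def)
  qed (use C in simp)
  then show ?thesis by (rule lipschitz_on_continuous_on)
qed

text \<open>The continuous function \<open>N\<close> attains a minimum on the compact unit sphere;
  it is positive by definiteness, and homogeneity carries the bound to all vectors.\<close>

lemma bound_below: "\<exists>c>0. \<forall>v. c * norm v \<le> N v"
proof -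
  let ?S = "sphere 0 1 :: (complex ^ 'n) set"
  have "compact ?S" "?S \<noteq> {}" by auto
  then obtain s where s: "s \<in> ?S" "\<And>v. v \<in> ?S \<Longrightarrow> N s \<le> N v"
    using continuous_attains_inf[of ?S N] continuous by blast
  have "s \<noteq> 0" using s by auto
  then have "N s > 0"
    using eq_zero[of s] nonneg[of s] by (auto simp: less_le)
  moreover have "N s * norm v \<le> N v" for v
  proof (cases "v = 0")
    case False
    have "N s \<le> N (of_real (1 / norm v) *s v)"
      using False by (intro s) (simp add: norm_vector_scale norm_divide)
    then show ?thesis using False by (simp add: scale norm_divide field_simps)
  qed (simp add: zero)
  ultimately show ?thesis by blast
qed

text \<open>
  On the span of \<open>u\<close> and \<open>h\<close>, the point \<open>u / N u\<close> of \<open>{N = 1}\<close> is nearest to the origin, so the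
  supporting hyperplane there is orthogonal to \<open>u\<close>. Writing \<open>u\<close> as a convex combination of \<open>u + h\<close> and
  \<open>u - s h\<close> and letting \<open>s\<close> tend to \<open>0\<close> replaces the appeal to supporting hyperplanes.
\<close>

lemma le_add_orthogonal:
  assumes u: "norm u = 1"
    and max: "\<And>s::real. N (u - of_real s *s h) \<le> N u * norm (u - of_real s *s h)"
    and orth: "hermitian_inner h u = 0"
  shows "N u \<le> N (u + h)"
proof (rule field_le_epsilon)
  fix e :: real
  assume e: "e > 0"
  \<comment> \<open>\<open>s\<close> is chosen so that the final error \<open>s * Q\<close> equals
    \<open>e\<close>; the added 1 keeps \<open>Q\<close> positive even when
    \<open>h = 0\<close>.\<close>
  define Q where "Q = N u * (norm h)\<^sup>2 + 1"
  define s where "s = e / Q"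
  have Q: "Q > 0" using nonneg[of u] by (simp add: Q_def add_nonneg_pos)
  have s: "s > 0" using e Q by (simp add: s_def)
  have sc: "of_real s *s h = s *\<^sub>R h"
    by (simp add: vec_eq_iff) (simp add: scaleR_conv_of_real)
  have "h \<bullet> u = 0" using orth Re_hermitian_inner[of h u] by simp
  then have "(norm (u - s *\<^sub>R h))\<^sup>2 = 1 + s\<^sup>2 * (norm h)\<^sup>2"
    using u unfolding power2_norm_eq_inner norm_eq_1
    by (simp add: inner_diff_left inner_diff_right inner_commute power2_eq_square)
  \<comment> \<open>Orthogonality makes the norm of \<open>u - s h\<close> exceed 1 only to second
    order in \<open>s\<close>, so a factor \<open>s\<close> is left in the error after dividing by
    \<open>s\<close>. Squaring the right side avoids a square root.\<close>
  also have "\<dots> \<le> (1 + s\<^sup>2 * (norm h)\<^sup>2)\<^sup>2"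
    by (rule self_le_power) simp_all
  finally have "norm (u - s *\<^sub>R h) \<le> 1 + s\<^sup>2 * (norm h)\<^sup>2"
    by (rule power2_le_imp_le) simp
  then have "N u * norm (u - s *\<^sub>R h) \<le> N u * (1 + s\<^sup>2 * (norm h)\<^sup>2)"
    by (rule mult_left_mono) (rule nonneg)
  then have far: "N (u - of_real s *s h) \<le> N u + s * s * (N u * (norm h)\<^sup>2)"
    using max[of s] by (simp add: sc algebra_simps power2_eq_square)
  have "of_real (1 + s) *s u = of_real s *s (u + h) + (u - of_real s *s h)"
    by (simp add: vec_eq_iff algebra_simps)
  then have "N (of_real (1 + s) *s u) \<le> N (of_real s *s (u + h)) + N (u - of_real s *s h)"
    by (metis triangle)
  moreover have "cmod (of_real (1 + s)) = 1 + s" "cmod (of_real s) = s"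
    using s by (simp_all only: norm_of_real)
  ultimately have "(1 + s) * N u \<le> s * N (u + h) + N (u - of_real s *s h)"
    by (simp only: scale)
  with far have "s * N u \<le> s * (N (u + h) + s * (N u * (norm h)\<^sup>2))"
    by (simp add: algebra_simps)
  then have "N u \<le> N (u + h) + s * (N u * (norm h)\<^sup>2)"
    using s by simp
  also have "\<dots> \<le> N (u + h) + s * Q"
    using s by (simp add: Q_def)
  also have "\<dots> = N (u + h) + e"
    using Q by (simp add: s_def)
  finally show "N u \<le> N (u + h) + e" .
qed

text \<open>Dividing \<open>v\<close> by its coefficient \<open>a\<close> along \<open>u\<close>
  gives \<open>u + h\<close> with \<open>h\<close> orthogonal to \<open>u\<close>, so
  \<open>le_add_orthogonal\<close> applies. The closure conditions on \<open>W\<close> keep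
  \<open>h\<close> and every \<open>u - s h\<close> inside the set over which \<open>u\<close> is
  maximal.\<close>

lemma coefficient_le:
  assumes u: "norm u = 1" "u \<in> W" and v: "v \<in> W"
    and W: "\<And>w z. w \<in> W \<Longrightarrow> z \<in> W \<Longrightarrow> w - z \<in> W" "\<And>c w. w \<in> W \<Longrightarrow> c *s w \<in> W"
    and max: "\<And>w. w \<in> W \<Longrightarrow> norm w = 1 \<Longrightarrow> N w \<le> N u"
  shows "cmod (hermitian_inner v u) * N u \<le> N v"
proof (cases "hermitian_inner v u = 0")
  case False
  define a where "a = hermitian_inner v u"
  define h where "h = (1 / a) *s v - u"
  have a: "a \<noteq> 0" using False by (simp add: a_def)
  have "h \<in> W" unfolding h_def by (intro W u v)
  have all: "N w \<le> N u * norm w" if "w \<in> W" for w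
  proof (cases "w = 0")
    case False
    have "N (of_real (1 / norm w) *s w) \<le> N u"
      using False that by (intro max W) (simp_all add: norm_vector_scale norm_divide)
    then show ?thesis using False by (simp add: scale norm_divide field_simps)
  qed (simp add: zero)
  have "hermitian_inner h u = 0"
    using a u by (simp add: h_def hermitian_inner_diff_left hermitian_inner_scale_left
        hermitian_inner_self flip: a_def)
  then have "N u \<le> N (u + h)"
    using u \<open>h \<in> W\<close> by (intro le_add_orthogonal all W) auto
  then have "N u \<le> N v / cmod a"
    by (simp add: h_def scale norm_divide)
  then show ?thesis using a by (simp add: a_def field_simps)
qed (simp add: nonneg)

end

section \<open>Stretching factors and convex metrics\<close>

lemma complement_below_diff:
  "v \<in> complement_below u \<alpha> \<Longrightarrow> w \<in> complement_below u \<alpha> \<Longrightarrow> v - w \<in> complement_below u \<alpha>"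
  by (simp add: complement_below_def hermitian_inner_diff_left)

lemma complement_below_scale: "v \<in> complement_below u \<alpha> \<Longrightarrow> c *s v \<in> complement_below u \<alpha>"
  by (simp add: complement_below_def hermitian_inner_scale_left)

text \<open>Subtracting from \<open>v\<close> its components along the earlier vectors gives
  \<open>w\<close> in \<open>complement_below u \<alpha>\<close> with the same coefficient along
  \<open>u \<alpha>\<close>. So \<open>coefficient_le\<close> applies to \<open>w\<close>, and the
  triangle inequality with the bounds for smaller indices controls \<open>F x w\<close>.\<close>

lemma stretching_coefficient_le:
  fixes u :: "'n::{finite,linorder} \<Rightarrow> (complex, 'n) vec"
  assumes N: "complex_norm (F x)" and u: "stretching_basis F x u"
  shows "cmod (hermitian_inner v (u \<alpha>)) * F x (u \<alpha>)
    \<le> real (CARD('n) + 1) ^ card {..<\<alpha>} * F x v"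
proof (induction "card {..<\<alpha>}" arbitrary: \<alpha> rule: less_induct)
  case less
  interpret complex_norm "F x" by (rule N)
  let ?K = "real (CARD('n) + 1)" and ?a = "\<lambda>\<beta>. hermitian_inner v (u \<beta>)"
  note orthonormal = stretching_basis_orthonormal[OF u]
  define w where "w = v - (\<Sum>\<beta><\<alpha>. ?a \<beta> *s u \<beta>)"
  have inner_w: "hermitian_inner w (u \<gamma>) = (if \<gamma> < \<alpha> then 0 else ?a \<gamma>)" for \<gamma>
    by (simp add: w_def hermitian_inner_diff_left hermitian_inner_sum_left
        hermitian_inner_scale_left orthonormal if_distrib[of "\<lambda>z. _ * z"] cong: if_cong)
  have "w \<in> complement_below u \<alpha>"
    by (simp add: complement_below_def inner_w)
  then have "cmod (?a \<alpha>) * F x (u \<alpha>) \<le> F x w"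
    using coefficient_le[of "u \<alpha>" "complement_below u \<alpha>" w] u
    by (auto simp: inner_w stretching_basis_def complement_below_diff complement_below_scale)
  also have "\<dots> \<le> F x v + (\<Sum>\<beta><\<alpha>. cmod (?a \<beta>) * F x (u \<beta>))"
    using triangle_diff[of v "\<Sum>\<beta><\<alpha>. ?a \<beta> *s u \<beta>"] sum_le[of "\<lambda>\<beta>. ?a \<beta> *s u \<beta>" "{..<\<alpha>}"]
    by (simp add: w_def scale)
  also have "\<dots> \<le> ?K ^ card {..<\<alpha>} * F x v"
  proof (cases "{..<\<alpha>} = {}")
    case True
    then show ?thesis by simp
  next
    case False
    then obtain k where k: "card {..<\<alpha>} = Suc k"
      by (metis card_eq_0_iff finite not0_implies_Suc)
    have "cmod (?a \<beta>) * F x (u \<beta>) \<le> ?K ^ k * F x v" if "\<beta> < \<alpha>" for \<beta>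
    proof -
      have lt: "card {..<\<beta>} < card {..<\<alpha>}"
        using that by (intro psubset_card_mono) auto
      have "cmod (?a \<beta>) * F x (u \<beta>) \<le> ?K ^ card {..<\<beta>} * F x v"
        using less lt by blast
      also have "\<dots> \<le> ?K ^ k * F x v"
        using lt k by (intro mult_right_mono power_increasing nonneg) auto
      finally show ?thesis .
    qed
    then have "(\<Sum>\<beta><\<alpha>. cmod (?a \<beta>) * F x (u \<beta>)) \<le> real (card {..<\<alpha>}) * (?K ^ k * F x v)"
      by (intro sum_bounded_above) auto
    also have "\<dots> \<le> real CARD('n) * (?K ^ k * F x v)"
      by (intro mult_right_mono) (auto intro!: card_mono simp: nonneg)
    finally have "(\<Sum>\<beta><\<alpha>. cmod (?a \<beta>) * F x (u \<beta>)) \<le> real CARD('n) * (?K ^ k * F x v)" .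
    \<comment> \<open>The total is now at most \<open>(1 + CARD('n)) * ?K ^ k * F x v\<close>; this
      explains the choice of \<open>?K\<close>.\<close>
    moreover have "1 * F x v \<le> ?K ^ k * F x v"
      by (intro mult_right_mono one_le_power nonneg) auto
    ultimately show ?thesis unfolding k by (simp add: algebra_simps)
  qed
  finally show ?case .
qed

text \<open>The coordinates of \<open>L v\<close> have moduli
  \<open>cmod (?a \<alpha>) * F x (u \<alpha>)\<close>. The triangle inequality for the expansion of
  \<open>v\<close> gives the first bound, \<open>stretching_coefficient_le\<close> the
  second.\<close>

lemma stretching_factor_comparable:
  fixes L :: "(complex, 'n::{finite,linorder}) vec \<Rightarrow> (complex, 'n) vec"
  assumes N: "complex_norm (F x)" and L: "stretching_factor F x L"
  shows "F x v \<le> real CARD('n) * norm (L v)"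
    and "norm (L v) \<le> real CARD('n) * real (CARD('n) + 1) ^ CARD('n) * F x v"
proof -
  interpret complex_norm "F x" by (rule N)
  from L obtain u where lin: "Vector_Spaces.linear (*s) (*s) L" and u: "stretching_basis F x u"
    and Lu: "\<And>\<alpha>. L (u \<alpha>) = of_real (F x (u \<alpha>)) *s axis \<alpha> 1"
    by (auto simp: stretching_factor_def)
  let ?K = "real (CARD('n) + 1)" and ?a = "\<lambda>\<alpha>. hermitian_inner v (u \<alpha>)"
  have v: "v = (\<Sum>\<alpha>\<in>UNIV. ?a \<alpha> *s u \<alpha>)"
    by (rule orthonormal_expansion) (rule stretching_basis_orthonormal[OF u])
  interpret L: Vector_Spaces.linear "(*s)" "(*s)" L by (rule lin)
  have "L v = (\<Sum>\<alpha>\<in>UNIV. ?a \<alpha> *s (of_real (F x (u \<alpha>)) *s axis \<alpha> 1))"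
    by (subst v) (simp add: L.sum L.scale Lu)
  then have coord: "L v $ \<alpha> = ?a \<alpha> * of_real (F x (u \<alpha>))" for \<alpha>
    by (simp add: axis_def if_distrib cong: if_cong)
  have cmod_coord: "cmod (L v $ \<alpha>) = cmod (?a \<alpha>) * F x (u \<alpha>)" for \<alpha>
    by (simp add: coord norm_mult nonneg)
  have "F x v \<le> (\<Sum>\<alpha>\<in>UNIV. cmod (?a \<alpha>) * F x (u \<alpha>))"
    using sum_le[of "\<lambda>\<alpha>. ?a \<alpha> *s u \<alpha>" UNIV] v by (simp add: scale)
  also have "\<dots> \<le> of_nat CARD('n) * norm (L v)"
    by (intro sum_bounded_above)
      (simp add: Finite_Cartesian_Product.norm_nth_le flip: cmod_coord)
  finally show "F x v \<le> real CARD('n) * norm (L v)" .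
  have "norm (L v) \<le> (\<Sum>\<alpha>\<in>UNIV. cmod (L v $ \<alpha>))"
    by (simp add: norm_vec_def L2_set_le_sum)
  also have "\<dots> \<le> of_nat CARD('n) * (?K ^ CARD('n) * F x v)"
  proof (rule sum_bounded_above)
    fix \<alpha>
    have "cmod (L v $ \<alpha>) \<le> ?K ^ card {..<\<alpha>} * F x v"
      unfolding cmod_coord by (rule stretching_coefficient_le[where F = F, OF N u])
    also have "\<dots> \<le> ?K ^ CARD('n) * F x v"
      by (intro mult_right_mono power_increasing nonneg card_mono) auto
    finally show "cmod (L v $ \<alpha>) \<le> ?K ^ CARD('n) * F x v" .
  qed
  finally show "norm (L v) \<le> real CARD('n) * ?K ^ CARD('n) * F x v"
    by (simp add: mult.assoc)
qed

text \<open>Convexity enters through the triangle inequality, by the usual gauge argument: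
  \<open>(v + w) / (s + t)\<close> is a convex combination of \<open>v / s\<close> and
  \<open>w / t\<close>.\<close>

lemma complex_norm_metric:
  assumes F: "finsler_metric \<Omega> F" and conv: "convex_metric \<Omega> F" and x: "x \<in> \<Omega>"
  shows "complex_norm (F x)"
proof
  have scale: "F x (c *s v) = cmod c * F x v" for c v
    using F x by (simp add: finsler_metric_def)
  show nonneg: "0 \<le> F x v" for v
    using F x by (simp add: finsler_metric_def)
  show "v = 0" if "F x v = 0" for v
    using F x that by (simp add: finsler_metric_def)
  show "F x (c *s v) = cmod c * F x v" for c v by (rule scale)
  show "F x (v + w) \<le> F x v + F x w" for v w
  proof (rule field_le_epsilon)
    fix e :: real
    assume e: "e > 0"
    \<comment> \<open>The margin \<open>e / 2\<close> makes \<open>s\<close> and \<open>t\<close>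
      positive and gives the strict inequality that membership in the indicatrix demands.\<close>
    define s where "s = F x v + e / 2"
    define t where "t = F x w + e / 2"
    have st: "s > 0" "t > 0" "F x v < s" "F x w < t"
      using e nonneg[of v] nonneg[of w] by (auto simp: s_def t_def)
    have "of_real (1 / s) *s v \<in> indicatrix F x" "of_real (1 / t) *s w \<in> indicatrix F x"
      using st unfolding indicatrix_def by (simp_all add: scale norm_divide)
    moreover have "convex (indicatrix F x)"
      using conv x by (simp add: convex_metric_def)
    ultimately have "(s / (s + t)) *\<^sub>R (of_real (1 / s) *s v) + (t / (s + t)) *\<^sub>R (of_real (1 / t) *s w)
        \<in> indicatrix F x"
      using st by (intro convexD) (auto simp flip: add_divide_distrib)
    also have "(s / (s + t)) *\<^sub>R (of_real (1 / s) *s v) + (t / (s + t)) *\<^sub>R (of_real (1 / t) *s w)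
        = of_real (1 / (s + t)) *s (v + w)"
      using st by (simp add: vec_eq_iff) (simp add: scaleR_conv_of_real field_simps)
    finally have "cmod (of_real (1 / (s + t))) * F x (v + w) < 1"
      by (simp only: indicatrix_def scale mem_Collect_eq)
    then have "F x (v + w) < s + t"
      using st by (simp only: norm_of_real) (simp add: field_simps)
    then show "F x (v + w) \<le> F x v + F x w + e"
      by (simp add: s_def t_def)
  qed
qed

section \<open>Bounded matrices and subsequential convergence\<close>

lemma bounded_bilinear_matrix_vector_mult:
  "bounded_bilinear ((*v) :: complex ^ 'n ^ 'm \<Rightarrow> complex ^ 'n \<Rightarrow> complex ^ 'm)"
proof -
  have "bilinear ((*v) :: complex ^ 'n ^ 'm \<Rightarrow> complex ^ 'n \<Rightarrow> complex ^ 'm)"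
    unfolding bilinear_def
    by (intro conjI allI linearI)
      (simp_all add: matrix_vector_mult_def vec_eq_iff sum.distrib scaleR_right.sum algebra_simps)
  then show ?thesis using bilinear_conv_bounded_bilinear by blast
qed

text \<open>Entries are coordinates of images of standard basis vectors. This turns a uniform
  operator bound into boundedness of the set of matrices, from which a convergent subsequence can be
  extracted.\<close>

lemma bounded_matrices:
  fixes M :: "'a \<Rightarrow> complex ^ 'n ^ 'm"
  assumes "\<And>j v. norm (M j *v v) \<le> C * norm v"
  shows "bounded (range M)"
proof -
  have col: "norm (M j $ i $ k) \<le> C" for j i k
  proof -
    have "M j $ i $ k = (M j *v axis k 1) $ i"
      by (simp add: matrix_vector_mult_def axis_def if_distrib cong: if_cong)
    also have "norm \<dots> \<le> norm (M j *v axis k 1)" by (rule Finite_Cartesian_Product.norm_nth_le)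
    also have "\<dots> \<le> C" using assms[of j "axis k 1"] by simp
    finally show ?thesis .
  qed
  have "norm (M j) \<le> of_nat CARD('m) * (of_nat CARD('n) * C)" for j
  proof -
    have "norm (M j) \<le> (\<Sum>i\<in>UNIV. norm (M j $ i))"
      by (simp add: norm_vec_def[of "M j"] L2_set_le_sum)
    also have "\<dots> \<le> of_nat CARD('m) * (of_nat CARD('n) * C)"
    proof (rule sum_bounded_above)
      fix i
      have "norm (M j $ i) \<le> (\<Sum>k\<in>UNIV. norm (M j $ i $ k))"
        by (simp add: norm_vec_def[of "M j $ i"] L2_set_le_sum)
      also have "\<dots> \<le> of_nat CARD('n) * C"
        by (intro sum_bounded_above col)
      finally show "norm (M j $ i) \<le> of_nat CARD('n) * C" .
    qed
    finally show ?thesis .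
  qed
  then show ?thesis unfolding bounded_iff by blast
qed

lemma matrix_inv_inverse:
  assumes "invertible A"
  shows "A ** matrix_inv A = mat 1" "matrix_inv A ** A = mat 1"
  using someI_ex[OF assms[unfolded invertible_def]] by (simp_all add: matrix_inv_def)

text \<open>A further subsequence \<open>s\<close> makes the matrices converge to some
  \<open>A\<close>; the products then converge to \<open>A *v l z\<close>. Both directions of the
  equivalence are instances.\<close>

lemma converges_subsequentially_mult:
  fixes M :: "nat \<Rightarrow> complex ^ 'm ^ 'k" and f :: "nat \<Rightarrow> complex ^ 'n \<Rightarrow> complex ^ 'm"
  assumes bound: "\<And>j v. norm (M j *v v) \<le> C * norm v"
    and cont: "\<And>j. continuous_on \<Omega> (f j)"
    and f: "converges_subsequentially \<Omega> f"
    and g: "\<And>j z. z \<in> \<Omega> \<Longrightarrow> g j z = M j *v f j z"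
  shows "converges_subsequentially \<Omega> g"
proof -
  obtain r l where r: "strict_mono r"
    and l: "\<And>K. compact K \<Longrightarrow> K \<subseteq> \<Omega> \<Longrightarrow> uniform_limit K (\<lambda>k. f (r k)) l sequentially"
    using f unfolding converges_subsequentially_def by blast
  have "bounded (range (M \<circ> r))"
    by (rule bounded_subset[OF bounded_matrices[OF bound]]) auto
  then obtain A s where s: "strict_mono s" and "((M \<circ> r) \<circ> s) \<longlonglongrightarrow> A"
    using bounded_imp_convergent_subsequence by blast
  then have A: "(\<lambda>k. M (r (s k))) \<longlonglongrightarrow> A"
    by (simp add: o_def)
  have "uniform_limit K (\<lambda>k. g (r (s k))) (\<lambda>z. A *v l z) sequentially"
    if K: "compact K" "K \<subseteq> \<Omega>" for K
  proof -
    have lim: "uniform_limit K (\<lambda>k. f (r (s k))) l sequentially"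
      using filterlim_compose[OF l[OF K] filterlim_subseq[OF s]] .
    \<comment> \<open>A product of uniform limits converges uniformly when both limits are bounded;
      for \<open>l\<close> this follows from continuity on the compact set \<open>K\<close>.\<close>
    have "continuous_on K l"
      by (rule uniform_limit_theorem[OF _ lim])
        (auto intro!: always_eventually continuous_on_subset[OF cont K(2)])
    then have "bounded (l ` K)"
      using K compact_continuous_image compact_imp_bounded by blast
    moreover have "uniform_limit K (\<lambda>k z. M (r (s k))) (\<lambda>z. A) sequentially"
      using tendstoD[OF A] by (auto simp: uniform_limit_iff elim!: eventually_mono)
    moreover have "bounded ((\<lambda>z. A) ` K)"
      by (rule bounded_subset[of "{A}"]) auto
    ultimately have "uniform_limit K (\<lambda>k z. M (r (s k)) *v f (r (s k)) z) (\<lambda>z. A *v l z) sequentially"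
      using lim bounded_bilinear.bounded_uniform_limit[OF bounded_bilinear_matrix_vector_mult]
      by blast
    moreover have "g j z = M j *v f j z" if "z \<in> K" for j z
      using g K that by blast
    ultimately show ?thesis
      by (simp cong: uniform_limit_cong')
  qed
  then show ?thesis
    unfolding converges_subsequentially_def
    using strict_mono_o[OF r s] by (intro exI[of _ "r \<circ> s"]) (auto simp: o_def)
qed

section \<open>Passage between the two rescaled sequences\<close>

theorem theorem2p2:
  fixes \<Omega> :: "(complex, 'n::{finite,linorder}) vec set"
    and p :: "(complex, 'n) vec"
    and \<phi> :: "nat \<Rightarrow> (complex, 'n) vec \<Rightarrow> (complex, 'n) vec"
    and F :: "(complex, 'n) vec \<Rightarrow> (complex, 'n) vec \<Rightarrow> real"
    and L :: "nat \<Rightarrow> (complex, 'n) vec \<Rightarrow> (complex, 'n) vec"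
  assumes "domain \<Omega>"
    and "p \<in> \<Omega>"
    and "\<And>j. holomorphic_automorphism \<Omega> (\<phi> j)"
    and "finsler_metric \<Omega> F"
    and "convex_metric \<Omega> F"
    and "invariant_metric \<Omega> F"
    and "\<And>j. stretching_factor F (\<phi> j p) (L j)"
  shows "converges_subsequentially \<Omega> (\<lambda>j z. matrix_inv (jacobian (\<phi> j) (at p)) *v (\<phi> j z - \<phi> j p)) \<longleftrightarrow>
         converges_subsequentially \<Omega> (\<lambda>j z. L j (\<phi> j z - \<phi> j p))"
proof -
  define A where "A j = jacobian (\<phi> j) (at p)" for j
  define M where "M j = matrix (L j) ** A j" for j
  let ?n = "real CARD('n)" and ?K = "real (CARD('n) + 1)"
  let ?\<tau> = "\<lambda>j z. matrix_inv (A j) *v (\<phi> j z - \<phi> j p)"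
  let ?\<sigma> = "\<lambda>j z. L j (\<phi> j z - \<phi> j p)"
  have L: "L j v = matrix (L j) *v v" for j v
    using assms(7)[of j] by (simp add: stretching_factor_def matrix_works)
  have "\<phi> j p \<in> \<Omega>" for j
    using assms(2,3) by (meson bij_betwE holomorphic_automorphism_def)
  then have norm_j: "complex_norm (F (\<phi> j p))" for j
    using assms(4,5) complex_norm_metric by blast
  interpret complex_norm "F p"
    by (rule complex_norm_metric[OF assms(4,5,2)])
  \<comment> \<open>Both constants belong to the norm at the fixed point \<open>p\<close>, so the
    bounds below are uniform in \<open>j\<close>.\<close>
  obtain C where C: "C > 0" "\<And>v. F p v \<le> C * norm v" using bound_above by blast
  obtain c where c: "c > 0" "\<And>v. c * norm v \<le> F p v" using bound_below by blast
  have inv: "F (\<phi> j p) (A j *v v) = F p v" for j v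
    using assms(2,3,6) by (simp add: invariant_metric_def A_def)
  have M: "M j *v v = L j (A j *v v)" for j v
    by (simp add: M_def L matrix_vector_mul_assoc)
  have upper: "norm (M j *v v) \<le> (?n * ?K ^ CARD('n) * C) * norm v" for j v
  proof -
    have "norm (M j *v v) \<le> ?n * ?K ^ CARD('n) * F p v"
      using stretching_factor_comparable(2)[OF norm_j assms(7), of j "A j *v v"]
      by (simp only: M inv)
    also have "\<dots> \<le> ?n * ?K ^ CARD('n) * (C * norm v)"
      by (intro mult_left_mono C) auto
    finally show ?thesis by (simp only: mult.assoc)
  qed
  have lower: "norm v \<le> ?n / c * norm (M j *v v)" for j v
  proof -
    have "F p v \<le> ?n * norm (M j *v v)"
      using stretching_factor_comparable(1)[OF norm_j assms(7), of j "A j *v v"]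
      by (simp only: M inv)
    then have "c * norm v \<le> ?n * norm (M j *v v)"
      using c(2)[of v] by linarith
    then show ?thesis using c by (simp add: field_simps)
  qed
  have "inj ((*v) (M j))" for j
    unfolding vec.inj_iff_eq_0
  proof (intro allI impI)
    fix v assume "M j *v v = 0"
    then show "v = 0" using lower[of v j] by simp
  qed
  then have "invertible (M j)" for j
    using invertible_left_inverse matrix_left_invertible_injective by blast
  then have M_inv: "matrix_inv (M j) ** M j = mat 1" "M j ** matrix_inv (M j) = mat 1" for j
    by (simp_all add: matrix_inv_inverse)
  \<comment> \<open>By invariance a kernel vector has \<open>F p v = 0\<close>. Invertibility of
    \<open>A j\<close> is what makes the chosen \<open>matrix_inv (A j)\<close> a genuine
    inverse.\<close>
  have "A j *v v = 0 \<Longrightarrow> v = 0" for j v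
    using inv[of j v] eq_zero[of v] complex_norm.zero[OF norm_j] by simp
  then have "invertible (A j)" for j
    using invertible_left_inverse matrix_left_invertible_ker by blast
  then have A_inv: "A j ** matrix_inv (A j) = mat 1" for j
    by (simp add: matrix_inv_inverse)
  have \<sigma>: "?\<sigma> j z = M j *v ?\<tau> j z" for j z
  proof -
    have "A j *v ?\<tau> j z = \<phi> j z - \<phi> j p"
      by (simp add: matrix_vector_mul_assoc A_inv)
    then show ?thesis by (simp only: M)
  qed
  have \<tau>: "?\<tau> j z = matrix_inv (M j) *v ?\<sigma> j z" for j z
    unfolding \<sigma> by (simp add: matrix_vector_mul_assoc M_inv matrix_mul_assoc)
  have lower': "norm (matrix_inv (M j) *v v) \<le> ?n / c * norm v" for j v
    using lower[of "matrix_inv (M j) *v v" j] by (simp add: matrix_vector_mul_assoc M_inv)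
  \<comment> \<open>The matrix \<open>B\<close> is arbitrary in order to cover both
    \<open>matrix_inv (A j)\<close> and \<open>matrix (L j)\<close>.\<close>
  have cont: "continuous_on \<Omega> (\<lambda>z. B *v (\<phi> j z - \<phi> j p))" for B :: "((complex, 'n) vec, 'n) vec" and j
  proof -
    have "continuous_on \<Omega> (\<phi> j)"
      using assms(3)[of j] unfolding holomorphic_automorphism_def holomorphic_map_on_def
      by (meson continuous_at_imp_continuous_on has_derivative_continuous)
    then show ?thesis
      by (intro bounded_bilinear.continuous_on[OF bounded_bilinear_matrix_vector_mult]
          continuous_intros)
  qed
  have cont_\<sigma>: "continuous_on \<Omega> (?\<sigma> j)" for j
    using cont[of "matrix (L j)" j] by (simp flip: L)
  have "converges_subsequentially \<Omega> ?\<tau> \<longleftrightarrow> converges_subsequentially \<Omega> ?\<sigma>"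
  proof
    assume "converges_subsequentially \<Omega> ?\<tau>"
    then show "converges_subsequentially \<Omega> ?\<sigma>"
      by (rule converges_subsequentially_mult[OF upper cont _ \<sigma>])
  next
    assume "converges_subsequentially \<Omega> ?\<sigma>"
    then show "converges_subsequentially \<Omega> ?\<tau>"
      by (rule converges_subsequentially_mult[OF lower' cont_\<sigma> _ \<tau>])
  qed
  then show ?thesis by (simp add: A_def)
qed

end
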